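(* Let $X,Y,Z_1,Z_2$ be random variables such that $X,Y,Z_1$ are independent, $X,Y,Z_2$ are independent, and $Z_1,Z_2$ are comonotonic. Put $U=\max\{X,Z_1\}$ and $V=\max\{Y,Z_2\}$, and let $\varphi$ and $\psi$ be the generating functions associated with $(F_X,F_U)$ and $(F_Y,F_V)$ respectively, as defined in the context. Then a copula of the pair $(U,V)$ is the Marshall copula with generating functions $\varphi$ and $\psi$, \[ C(u,v)=\min\{u\psi(v),\,v\varphi(u)\},\qquad (u,v)\in[0,1]^2 .\] That is, $\varphi$ and $\psi$ are generating functions of a Marshall copula, and $\mathbb{P}[U\le x,V\le y]=C(F_U(x),F_V(y))$ for all $x,y\in\mathbb{R}$.
   Context: $F_W$ denotes the distribution function of a random variable $W$, $F_W(x)=\mathbb{P}[W\le x]$; $G_i$ denotes the distribution function of $Z_i$. $Z_1,Z_2$ are comonotonic if $\mathbb{P}[Z_1\le x,Z_2\le y]=\min\{G_1(x),G_2(y)\}$ for all $x,y$. A copula is a function $C:[0,1]^2\to[0,1]$ with $C(x,0)=C(0,x)=0$ and $C(x,1)=C(1,x)=x$ for all $x\in[0,1]$, and $C(x_2,y_2)-C(x_1,y_2)-C(x_2,y_1)+C(x_1,y_1)\ge 0$ whenever $x_1\le x_2$, $y_1\le y_2$. A copula $C$ is a copula of $(U,V)$ if the joint distribution function of $(U,V)$ equals $C(F_U(x),F_V(y))$. A Marshall copula is a copula of the form $C(u,v)=\min\{u g(v),f(u)v\}$, where each of the generating functions $f,g:[0,1]\to[0,1]$ satisfies (stated for $f$):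 $f(0)=0$, $f(1)=1$; $f$ is nondecreasing on $[0,1]$; and $f^*(u)=f(u)/u$ is nonincreasing on $(0,1]$. For a distribution function $F$ and $u\in[0,1]$, $F^{-1}(u)=\inf\{x\in\mathbb{R}: F(x)\ge u\}$, with $\inf\emptyset=+\infty$ and $\inf\mathbb{R}=-\infty$. Left limits are written $f(x-)$. For $u\notin \mathrm{im}\,F\cup\{0,1\}$ put $\overline{u}=F(F^{-1}(u))$ and $\underline{u}=F(F^{-1}(u)-)$. The function $\varphi$ associated with $(F_X,F_U)$ is defined, using $F=F_U$ for $\overline u,\underline u$, by $\varphi(0)=0$, $\varphi(1)=1$, $\varphi(u)=F_X(F_U^{-1}(u))$ for $u\in\mathrm{im}\,F_U\setminus\{0,1\}$, and for all other $u$ \[\varphi(u)=\frac{\varphi(\overline{u})-\varphi(\underline{u}-)}{\overline{u}-\underline{u}}(u-\underline{u})+\varphi(\underline{u}-).\] Here $\varphi(\underline u-)$ is the left limit of $\varphi$ at $\underline u$ when $\underline u>0$ (this is the number $F_X(F_U^{-1}(u)-)$), and $\varphi(0-):=0$. The function $\psi$ is defined in the same way from $(F_Y,F_V)$. *)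

theory Defs
  imports "HOL-Probability.Probability"
begin

definition dist_fun :: "'a measure \<Rightarrow> ('a \<Rightarrow> real) \<Rightarrow> real \<Rightarrow> real" where
  "dist_fun M W = cdf (distr M borel W)"

definition joint_dist_fun :: "'a measure \<Rightarrow> ('a \<Rightarrow> real) \<Rightarrow> ('a \<Rightarrow> real) \<Rightarrow> real \<Rightarrow> real \<Rightarrow> real" where
  "joint_dist_fun M W W' x y = measure M {\<omega> \<in> space M. W \<omega> \<le> x \<and> W' \<omega> \<le> y}"

definition comonotonic :: "'a measure \<Rightarrow> ('a \<Rightarrow> real) \<Rightarrow> ('a \<Rightarrow> real) \<Rightarrow> bool" where
  "comonotonic M Z1 Z2 \<longleftrightarrow>
     (\<forall>x y. joint_dist_fun M Z1 Z2 x y = min (dist_fun M Z1 x) (dist_fun M Z2 y))"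

text \<open>Copulas are functions on the unit square; only the values there are constrained.\<close>

definition copula :: "(real \<Rightarrow> real \<Rightarrow> real) \<Rightarrow> bool" where
  "copula C \<longleftrightarrow>
     (\<forall>u\<in>{0..1}. \<forall>v\<in>{0..1}. C u v \<in> {0..1}) \<and>
     (\<forall>x\<in>{0..1}. C x 0 = 0 \<and> C 0 x = 0 \<and> C x 1 = x \<and> C 1 x = x) \<and>
     (\<forall>x1\<in>{0..1}. \<forall>x2\<in>{0..1}. \<forall>y1\<in>{0..1}. \<forall>y2\<in>{0..1}. x1 \<le> x2 \<longrightarrow> y1 \<le> y2 \<longrightarrow>
        C x2 y2 - C x1 y2 - C x2 y1 + C x1 y1 \<ge> 0)"

definition copula_of :: "'a measure \<Rightarrow> ('a \<Rightarrow> real) \<Rightarrow> ('a \<Rightarrow> real) \<Rightarrow> (real \<Rightarrow> real \<Rightarrow> real) \<Rightarrow> bool" where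
  "copula_of M U V C \<longleftrightarrow>
     copula C \<and> (\<forall>x y. joint_dist_fun M U V x y = C (dist_fun M U x) (dist_fun M V y))"

definition marshall_generator :: "(real \<Rightarrow> real) \<Rightarrow> bool" where
  "marshall_generator f \<longleftrightarrow>
     f ` {0..1} \<subseteq> {0..1} \<and> f 0 = 0 \<and> f 1 = 1 \<and>
     mono_on {0..1} f \<and> antimono_on {0<..1} (\<lambda>u. f u / u)"

definition marshall :: "(real \<Rightarrow> real) \<Rightarrow> (real \<Rightarrow> real) \<Rightarrow> real \<Rightarrow> real \<Rightarrow> real" where
  "marshall f g u v = min (u * g v) (f u * v)"

text \<open>
  For a distribution function \<open>F\<close> and \<open>u\<close> strictly between 0 and 1 the set below is nonempty and
  bounded below, so that the real infimum is the extended real one.  The generalized inverse is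
  only ever taken at such \<open>u\<close>.
\<close>

definition quantile :: "(real \<Rightarrow> real) \<Rightarrow> real \<Rightarrow> real" where
  "quantile F u = Inf {x. F x \<ge> u}"

definition left_lim :: "(real \<Rightarrow> real) \<Rightarrow> real \<Rightarrow> real" where
  "left_lim F x = Lim (at_left x) F"

definition over :: "(real \<Rightarrow> real) \<Rightarrow> real \<Rightarrow> real" where
  "over F u = F (quantile F u)"

definition under :: "(real \<Rightarrow> real) \<Rightarrow> real \<Rightarrow> real" where
  "under F u = left_lim F (quantile F u)"

text \<open>
  Outside the image of \<open>F\<close> the value of \<open>\<phi>\<close> refers to the left limit of \<open>\<phi>\<close> itself at
  \<open>under F u\<close> (read as 0 if \<open>under F u = 0\<close>), so the defining equations are a system of
  conditions on \<open>\<phi>\<close>, including the existence of that left limit (called \<open>L\<close>).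
\<close>

definition gen_equations :: "(real \<Rightarrow> real) \<Rightarrow> (real \<Rightarrow> real) \<Rightarrow> (real \<Rightarrow> real) \<Rightarrow> bool" where
  "gen_equations H F \<phi> \<longleftrightarrow>
     \<phi> 0 = 0 \<and> \<phi> 1 = 1 \<and>
     (\<forall>u\<in>range F - {0, 1}. \<phi> u = H (quantile F u)) \<and>
     (\<forall>u\<in>{0..1} - (range F \<union> {0, 1}). \<exists>L.
        (if under F u > 0 then (\<phi> \<longlongrightarrow> L) (at_left (under F u)) else L = 0) \<and>
        \<phi> u = (\<phi> (over F u) - L) / (over F u - under F u) * (u - under F u) + L)"

definition gen_fun :: "(real \<Rightarrow> real) \<Rightarrow> (real \<Rightarrow> real) \<Rightarrow> real \<Rightarrow> real" where
  "gen_fun H F = (THE \<phi>. \<phi> \<in> extensional {0..1} \<and> gen_equations H F \<phi>)"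


text \<open>
  The system determines \<open>\<phi>\<close> on the unit interval when \<open>F\<close> is the product of \<open>H\<close> and another
  distribution function, as it is for the maximum of independent random variables.  In its
  solution \<open>L\<close> is \<open>left_lim H (quantile F u)\<close> whenever \<open>under F u > 0\<close>.
\<close>

lemma product_left_factor_eq:
  fixes h h' g g' :: real
  assumes "0 \<le> h" "h \<le> h'" "0 \<le> g" "g \<le> g'" "h * g = h' * g'" "0 < h * g"
  shows "h = h'"
proof (rule ccontr)
  assume "h \<noteq> h'"
  then have "h < h'" using assms by simp
  have "0 < g" using assms by (metis less_eq_real_def mult_zero_right order_less_irrefl)
  then have "h * g < h' * g" using \<open>h < h'\<close> by simp
  also have "\<dots> \<le> h' * g'" using assms by (intro mult_left_mono) auto
  finally show False using assms by simp
qed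

lemma tendsto_interpolation:
  fixes a b A B :: real
  assumes "a < b"
  shows "((\<lambda>t. (B - A) / (b - a) * (t - a) + A) \<longlongrightarrow> B) (at_left b)"
proof -
  have "((\<lambda>t. (B - A) / (b - a) * (t - a) + A) \<longlongrightarrow> (B - A) / (b - a) * (b - a) + A) (at_left b)"
    by (intro tendsto_intros)
  then show ?thesis using assms by simp
qed

lemma interpolation_bounds:
  fixes a b A B :: real
  assumes "a < b" "A \<le> B" "a \<le> t" "t \<le> b"
  shows "A \<le> (B - A) / (b - a) * (t - a) + A" "(B - A) / (b - a) * (t - a) + A \<le> B"
proof -
  show "A \<le> (B - A) / (b - a) * (t - a) + A" using assms by simp
  have "(B - A) / (b - a) * (t - a) \<le> (B - A) / (b - a) * (b - a)"
    using assms by (intro mult_left_mono) auto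
  then show "(B - A) / (b - a) * (t - a) + A \<le> B" using assms by simp
qed

locale cdf_product =
  fixes P Q :: "real measure"
  assumes P: "real_distribution P" and Q: "real_distribution Q"
begin

definition H :: "real \<Rightarrow> real" where "H = cdf P"
definition G :: "real \<Rightarrow> real" where "G = cdf Q"
definition F :: "real \<Rightarrow> real" where "F = (\<lambda>x. cdf P x * cdf Q x)"
definition Hm :: "real \<Rightarrow> real" where "Hm x = measure P {..<x}"
definition Gm :: "real \<Rightarrow> real" where "Gm x = measure Q {..<x}"
definition Fm :: "real \<Rightarrow> real" where "Fm x = Hm x * Gm x"

lemma F_eq: "F x = H x * G x" by (simp add: F_def H_def G_def)

interpretation P: cdf_distribution P using P by (simp add: cdf_distribution_def)
interpretation Q: cdf_distribution Q using Q by (simp add: cdf_distribution_def)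

lemma H_mono: "x \<le> y \<Longrightarrow> H x \<le> H y" unfolding H_def by (rule P.cdf_nondecreasing)
lemma G_mono: "x \<le> y \<Longrightarrow> G x \<le> G y" unfolding G_def by (rule Q.cdf_nondecreasing)
lemma H_range: "0 \<le> H x" "H x \<le> 1" unfolding H_def by (auto simp: P.cdf_nonneg P.cdf_bounded_prob)
lemma G_range: "0 \<le> G x" "G x \<le> 1" unfolding G_def by (auto simp: Q.cdf_nonneg Q.cdf_bounded_prob)
lemma Hm_nonneg: "0 \<le> Hm x" unfolding Hm_def by simp
lemma Gm_nonneg: "0 \<le> Gm x" unfolding Gm_def by simp
lemma H_Hm: "x < y \<Longrightarrow> H x \<le> Hm y" unfolding H_def Hm_def cdf_def
  by (intro P.finite_measure_mono) auto
lemma G_Gm: "x < y \<Longrightarrow> G x \<le> Gm y" unfolding G_def Gm_def cdf_def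
  by (intro Q.finite_measure_mono) auto
lemma Hm_H: "Hm x \<le> H x" unfolding H_def Hm_def cdf_def
  by (intro P.finite_measure_mono) auto
lemma Gm_G: "Gm x \<le> G x" unfolding G_def Gm_def cdf_def
  by (intro Q.finite_measure_mono) auto
lemma H_at_left: "(H \<longlongrightarrow> Hm x) (at_left x)" unfolding H_def Hm_def by (rule P.cdf_at_left)
lemma G_at_left: "(G \<longlongrightarrow> Gm x) (at_left x)" unfolding G_def Gm_def by (rule Q.cdf_at_left)
lemma F_at_left: "(F \<longlongrightarrow> Fm x) (at_left x)"
  unfolding F_eq[abs_def] Fm_def by (intro tendsto_mult H_at_left G_at_left)
lemma F_mono: "x \<le> y \<Longrightarrow> F x \<le> F y"
  unfolding F_eq by (intro mult_mono H_mono G_mono) (auto simp: H_range G_range)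
lemma F_range: "0 \<le> F x" "F x \<le> 1"
  unfolding F_eq using H_range[of x] G_range[of x] by (auto intro: mult_le_one)
lemma F_Fm: "x < y \<Longrightarrow> F x \<le> Fm y"
  unfolding F_eq Fm_def
  by (intro mult_mono H_Hm G_Gm) (auto simp: H_range G_range Hm_nonneg Gm_nonneg)
lemma Fm_F: "Fm x \<le> F x"
  unfolding F_eq Fm_def
  by (intro mult_mono Hm_H Gm_G) (auto simp: H_range G_range Hm_nonneg Gm_nonneg)
lemma Fm_nonneg: "0 \<le> Fm x"
  unfolding Fm_def by (simp add: Hm_nonneg Gm_nonneg)

sublocale F: right_continuous_mono F 0 1
proof
  show "continuous (at_right x) F" for x
    unfolding F_def by (intro continuous_mult P.cdf_is_right_cont Q.cdf_is_right_cont)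
  show "mono F" by (simp add: F_mono monoI)
  show "(F \<longlongrightarrow> 0) at_bot"
    unfolding F_def using tendsto_mult[OF P.cdf_lim_at_bot Q.cdf_lim_at_bot] by simp
  show "(F \<longlongrightarrow> 1) at_top"
    unfolding F_def using tendsto_mult[OF P.cdf_lim_at_top_prob Q.cdf_lim_at_top_prob] by simp
qed

lemma quantile_le: "0 < u \<Longrightarrow> u < 1 \<Longrightarrow> u \<le> F x \<longleftrightarrow> quantile F u \<le> x"
  unfolding quantile_def by (rule F.pseudoinverse)

lemma under_eq: "under F u = Fm (quantile F u)"
  unfolding under_def left_lim_def by (rule tendsto_Lim[OF _ F_at_left]) simp

lemma H_eq: "x \<le> y \<Longrightarrow> F x = F y \<Longrightarrow> 0 < F x \<Longrightarrow> H x = H y"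
  unfolding F_eq by (rule product_left_factor_eq[of _ _ "G x" "G y"]) (auto simp: H_mono G_mono H_range G_range)
lemma H_eq_Hm: "x < y \<Longrightarrow> F x = Fm y \<Longrightarrow> 0 < F x \<Longrightarrow> H x = Hm y"
  unfolding F_eq Fm_def
  by (rule product_left_factor_eq[of _ _ "G x" "Gm y"]) (auto simp: H_Hm G_Gm H_range G_range)
lemma Hm_eq_H: "Fm x = F x \<Longrightarrow> 0 < F x \<Longrightarrow> Hm x = H x"
  unfolding F_eq Fm_def
  by (rule product_left_factor_eq[of _ _ "Gm x" "G x"]) (auto simp: Hm_H Gm_G Hm_nonneg Gm_nonneg)

lemma quantile_image:
  assumes "0 < F x" "F x < 1"
  shows "quantile F (F x) \<le> x" "F (quantile F (F x)) = F x" "H (quantile F (F x)) = H x"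
proof -
  show 1: "quantile F (F x) \<le> x" using quantile_le[OF assms, of x] by simp
  show 2: "F (quantile F (F x)) = F x"
    using quantile_le[OF assms, of "quantile F (F x)"] F_mono[OF 1] by simp
  show "H (quantile F (F x)) = H x" using H_eq[OF 1 2] 2 assms by simp
qed

lemma F_one: "F x = 1 \<Longrightarrow> H x = 1"
  using H_range[of x] G_range[of x] unfolding F_eq
  by (metis mult_left_le order_antisym)

lemma H_image_one: "\<phi> 1 = 1 \<Longrightarrow> \<forall>u\<in>range F - {0, 1}. \<phi> u = H (quantile F u) \<Longrightarrow> 0 < F x \<Longrightarrow> \<phi> (F x) = H x"
  using F_one[of x] F_range[of x] quantile_image(3)[of x] by (cases "F x = 1") auto

lemma Fm_le:
  assumes "\<And>x. x < c \<Longrightarrow> F x \<le> u" shows "Fm c \<le> u"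
  by (rule tendsto_upperbound[OF F_at_left])
     (auto simp: eventually_at_filter assms)

lemma gap:
  assumes "0 < u" "u < 1" "u \<notin> range F"
  shows "Fm (quantile F u) \<le> u" "u < F (quantile F u)"
proof -
  show "Fm (quantile F u) \<le> u"
    using quantile_le[OF assms(1,2)] by (intro Fm_le) (meson linorder_not_le order_less_imp_le)
  show "u < F (quantile F u)"
    using quantile_le[OF assms(1,2), of "quantile F u"] assms(3) by (metis order_refl order_less_le rangeI)
qed

lemma gap_quantile:
  assumes "Fm b < t" "t < F b" "0 < t" "t < 1"
  shows "t \<notin> range F" "quantile F t = b"
proof -
  have *: "F x < t" if "x < b" for x using F_Fm[OF that] assms by simp
  show "t \<notin> range F"
  proof
    assume "t \<in> range F"
    then obtain x where "t = F x" by auto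
    then show False using *[of x] F_mono[of b x] assms by fastforce
  qed
  show "quantile F t = b"
    using quantile_le[OF assms(3,4)] * assms(2)
    by (metis linorder_not_less order_antisym order_less_imp_le order_refl)
qed

lemma F_filterlim:
  assumes "\<And>x. x < c \<Longrightarrow> F x < Fm c"
  shows "filterlim F (at_left (Fm c)) (at_left c)"
proof -
  have "eventually (\<lambda>x. F x \<in> {..<Fm c} \<and> F x \<noteq> Fm c) (at_left c)"
    using assms by (auto simp: eventually_at_filter intro!: always_eventually dest: less_imp_neq)
  then show ?thesis unfolding filterlim_at using F_at_left by blast
qed

lemma left_limit_unique:
  assumes \<phi>: "gen_equations H F \<phi>"
    and w: "w = Fm a" "0 < w" "w < 1" and L: "(\<phi> \<longlongrightarrow> L) (at_left w)"
  shows "L = Hm a"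
proof -
  have \<phi>F: "\<phi> (F x) = H x" if "0 < F x" for x
    using \<phi> that by (intro H_image_one) (auto simp: gen_equations_def)
  have A: "L = Hm c" if c: "w = Fm c" "\<And>x. x < c \<Longrightarrow> F x < w" for c
  proof -
    have "filterlim F (at_left w) (at_left c)"
      using F_filterlim[of c] c by simp
    then have 1: "((\<lambda>x. \<phi> (F x)) \<longlongrightarrow> L) (at_left c)"
      by (rule filterlim_compose[OF L])
    have "eventually (\<lambda>x. 0 < F x) (at_left c)"
      using order_tendstoD(1)[OF F_at_left, of 0 c] w c by simp
    then have "eventually (\<lambda>x. \<phi> (F x) = H x) (at_left c)"
      by eventually_elim (rule \<phi>F)
    from Lim_transform_eventually[OF 1 this] show ?thesis
      using H_at_left[of c] by (intro tendsto_unique[of "at_left c" H]) auto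
  qed
  show ?thesis
  proof (cases "\<forall>x<a. F x < w")
    case True
    then show ?thesis using A[of a] w by auto
  next
    case False
    then obtain b where b: "b < a" "F b = w" using F_Fm w by (metis order_antisym linorder_not_less)
    define b0 where "b0 = quantile F w"
    have b0: "b0 \<le> b" "F b0 = w" using quantile_image[of b] b w by (auto simp: b0_def)
    have Hb0: "H b0 = Hm a" using H_eq_Hm[of b0 a] b b0 w by auto
    have lt: "F x < w" if "x < b0" for x
      using quantile_le[of w x] that w unfolding b0_def by (meson linorder_not_less)
    show ?thesis
    proof (cases "Fm b0 = w")
      case True
      then have "L = Hm b0" using lt by (intro A) auto
      also have "\<dots> = H b0" using Hm_eq_H[of b0] True b0 w by simp
      finally show ?thesis using Hb0 by simp
    next
      case False
      then have lt': "Fm b0 < w" using Fm_F[of b0] b0 by simp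
      define R where "R K t \<longleftrightarrow> (if Fm b0 > 0 then (\<phi> \<longlongrightarrow> K) (at_left (Fm b0)) else K = 0) \<and>
        \<phi> t = (\<phi> w - K) / (w - Fm b0) * (t - Fm b0) + K" for K t
      have R: "\<exists>K. R K t" if "Fm b0 < t" "t < w" for t
      proof -
        have t: "0 < t" "t < 1" using that w Fm_nonneg[of b0] by auto
        note g = gap_quantile[of b0 t, OF that(1) _ t]
        have q: "t \<notin> range F" "quantile F t = b0" using g b0 that by auto
        have "t \<in> {0..1} - (range F \<union> {0, 1})" using t q by auto
        then have "\<exists>K. (if under F t > 0 then (\<phi> \<longlongrightarrow> K) (at_left (under F t)) else K = 0) \<and>
            \<phi> t = (\<phi> (over F t) - K) / (over F t - under F t) * (t - under F t) + K"
          using \<phi> unfolding gen_equations_def by blast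
        then show ?thesis unfolding R_def under_eq over_def q b0 .
      qed
      obtain K where K: "R K ((Fm b0 + w) / 2)" using R[of "(Fm b0 + w) / 2"] lt' by auto
      have RK: "R K t" if t: "Fm b0 < t" "t < w" for t
      proof -
        obtain K' where K': "R K' t" using R[OF t] by auto
        then have "K = K'"
          using K tendsto_unique[of "at_left (Fm b0)" \<phi> K K'] unfolding R_def by (auto split: if_splits)
        then show ?thesis using K' by simp
      qed
      have "eventually (\<lambda>t. (\<phi> w - K) / (w - Fm b0) * (t - Fm b0) + K = \<phi> t) (at_left w)"
        using eventually_at_left_real[OF lt'] by eventually_elim (use RK in \<open>auto simp: R_def\<close>)
      from Lim_transform_eventually[OF tendsto_interpolation[OF lt'] this]
      have "L = \<phi> w" using L by (intro tendsto_unique[of "at_left w" \<phi>]) auto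
      also have "\<dots> = H b0" using \<phi>F[of b0] b0 w by simp
      finally show ?thesis using Hb0 by simp
    qed
  qed
qed

definition sol :: "real \<Rightarrow> real" where
  "sol u = (let a = quantile F u; L = if Fm a > 0 then Hm a else 0 in
     if u \<notin> {0..1} then undefined else if u = 0 then 0 else if u = 1 then 1
     else if u \<in> range F then H a
     else (H a - L) / (F a - Fm a) * (u - Fm a) + L)"

lemma sol_image: "0 < F x \<Longrightarrow> sol (F x) = H x"
  by (rule H_image_one) (use F_range in \<open>auto simp: sol_def Let_def\<close>)

lemma sol_gap:
  assumes "0 < u" "u < 1" "u \<notin> range F"
  shows "sol u = (H (quantile F u) - (if Fm (quantile F u) > 0 then Hm (quantile F u) else 0)) /
     (F (quantile F u) - Fm (quantile F u)) * (u - Fm (quantile F u)) +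
     (if Fm (quantile F u) > 0 then Hm (quantile F u) else 0)"
  using assms by (simp add: sol_def Let_def)

lemma sol_left_limit:
  assumes w: "w = Fm a" "0 < w" "w < 1"
  shows "(sol \<longlongrightarrow> Hm a) (at_left w)"
proof -
  have A: "(sol \<longlongrightarrow> Hm c) (at_left w)" if c: "w = Fm c" "\<And>x. x < c \<Longrightarrow> F x < w" for c
  proof -
    have bound: "H x \<le> sol t \<and> sol t \<le> Hm c" if x: "x < c" "0 < F x" and t: "F x < t" "t < w" for x t
    proof -
      have t01: "0 < t" "t < 1" using x t w by auto
      define b where "b = quantile F t"
      have "x < b" using quantile_le[OF t01, of x] t unfolding b_def by auto
      have "eventually (\<lambda>y. t < F y) (at_left c)"
        using order_tendstoD(1)[OF F_at_left, of t c] t c by simp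
      moreover have "eventually (\<lambda>y. y < c) (at_left c)" by (auto simp: eventually_at_filter)
      ultimately have "eventually (\<lambda>y. t < F y \<and> y < c) (at_left c)" by eventually_elim auto
      then obtain y where "t < F y" "y < c"
        using eventually_happens'[of "at_left c"] by auto
      then have "b < c" using quantile_le[OF t01, of y] unfolding b_def by auto
      have 1: "H x \<le> Hm b" "H b \<le> Hm c" using H_Hm \<open>x < b\<close> \<open>b < c\<close> by auto
      show ?thesis
      proof (cases "t \<in> range F")
        case True
        then have "sol t = H b" using t01 by (simp add: sol_def Let_def b_def)
        then show ?thesis using 1 Hm_H[of b] by simp
      next
        case False
        have "0 < Fm b" using F_Fm[OF \<open>x < b\<close>] x by simp
        then have "sol t = (H b - Hm b) / (F b - Fm b) * (t - Fm b) + Hm b"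
          using sol_gap[OF t01 False] by (simp add: b_def)
        moreover have "Fm b \<le> t" "t < F b" using gap[OF t01 False] by (auto simp: b_def)
        ultimately show ?thesis
          using interpolation_bounds[of "Fm b" "F b" "Hm b" "H b" t] Hm_H[of b] 1
          by (metis less_imp_le order_trans order_le_less_trans)
      qed
    qed
    have ev: "eventually (\<lambda>x. x < c \<and> 0 < F x) (at_left c)"
      using order_tendstoD(1)[OF F_at_left, of 0 c] w c by (auto simp: eventually_at_filter elim: eventually_mono)
    show ?thesis
    proof (rule order_tendstoI)
      fix l assume "l < Hm c"
      then have "eventually (\<lambda>x. (x < c \<and> 0 < F x) \<and> l < H x) (at_left c)"
        using eventually_conj[OF ev order_tendstoD(1)[OF H_at_left]] by blast
      then obtain x where x: "x < c" "0 < F x" "l < H x"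
        using eventually_happens'[of "at_left c"] by auto
      show "eventually (\<lambda>t. l < sol t) (at_left w)"
        using eventually_at_left_real[OF c(2)[OF x(1)]]
        by eventually_elim (use bound[OF x(1,2)] x(3) in force)
    next
      fix l assume "Hm c < l"
      obtain x where x: "x < c" "0 < F x"
        using ev eventually_happens'[of "at_left c"] by auto
      show "eventually (\<lambda>t. sol t < l) (at_left w)"
        using eventually_at_left_real[OF c(2)[OF x(1)]]
        by eventually_elim (use bound[OF x(1,2)] \<open>Hm c < l\<close> in force)
    qed
  qed
  show ?thesis
  proof (cases "\<forall>x<a. F x < w")
    case True
    then show ?thesis using A[of a] w by auto
  next
    case False
    then obtain b where b: "b < a" "F b = w" using F_Fm w by (metis order_antisym linorder_not_less)
    define b0 where "b0 = quantile F w"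
    have b0: "b0 \<le> b" "F b0 = w" using quantile_image[of b] b w by (auto simp: b0_def)
    have Hb0: "H b0 = Hm a" using H_eq_Hm[of b0 a] b b0 w by auto
    have lt: "F x < w" if "x < b0" for x
      using quantile_le[of w x] that w unfolding b0_def by (meson linorder_not_less)
    show ?thesis
    proof (cases "Fm b0 = w")
      case True
      then have "(sol \<longlongrightarrow> Hm b0) (at_left w)" using lt by (intro A) auto
      also have "Hm b0 = H b0" using Hm_eq_H[of b0] True b0 w by simp
      finally show ?thesis using Hb0 by simp
    next
      case False
      then have lt': "Fm b0 < w" using Fm_F[of b0] b0 by simp
      define K where "K = (if Fm b0 > 0 then Hm b0 else 0)"
      have eq: "sol t = (H b0 - K) / (w - Fm b0) * (t - Fm b0) + K" if "Fm b0 < t" "t < w" for t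
      proof -
        have t: "0 < t" "t < 1" using that w Fm_nonneg[of b0] by auto
        have q: "t \<notin> range F" "quantile F t = b0"
          using gap_quantile[of b0 t, OF that(1) _ t] b0 that by auto
        show ?thesis using sol_gap[OF t q(1)] by (simp add: q(2) K_def b0)
      qed
      have "eventually (\<lambda>t. (H b0 - K) / (w - Fm b0) * (t - Fm b0) + K = sol t) (at_left w)"
        using eventually_at_left_real[OF lt'] by eventually_elim (use eq in auto)
      from Lim_transform_eventually[OF tendsto_interpolation[OF lt'] this]
      show ?thesis by (simp add: Hb0)
    qed
  qed
qed

lemma sol_equations: "gen_equations H F sol"
  unfolding gen_equations_def
proof (intro conjI ballI)
  show "sol 0 = 0" "sol 1 = 1" by (auto simp: sol_def)
  show "sol u = H (quantile F u)" if "u \<in> range F - {0, 1}" for u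
    using that F_range by (auto simp: sol_def Let_def)
  fix u assume "u \<in> {0..1} - (range F \<union> {0, 1})"
  then have u: "0 < u" "u < 1" "u \<notin> range F" by auto
  let ?a = "quantile F u"
  have "0 < F ?a" "Fm ?a < 1" using gap[OF u] u by auto
  then show "\<exists>L. (if under F u > 0 then (sol \<longlongrightarrow> L) (at_left (under F u)) else L = 0) \<and>
        sol u = (sol (over F u) - L) / (over F u - under F u) * (u - under F u) + L"
    using sol_gap[OF u] sol_left_limit[of "Fm ?a" ?a]
    by (intro exI[of _ "if Fm ?a > 0 then Hm ?a else 0"]) (auto simp: under_eq over_def sol_image)
qed

lemma equations_imp_sol:
  assumes \<phi>: "gen_equations H F \<phi>" and u: "u \<in> {0..1}"
  shows "\<phi> u = sol u"
proof (cases "u = 0 \<or> u = 1 \<or> u \<in> range F")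
  case True
  then show ?thesis using \<phi> u by (auto simp: gen_equations_def sol_def Let_def)
next
  case False
  then have u': "0 < u" "u < 1" "u \<notin> range F" using u by auto
  let ?a = "quantile F u"
  have a: "0 < F ?a" "Fm ?a < 1" using gap[OF u'] u' by auto
  then have "\<phi> (F ?a) = H ?a"
    using \<phi> by (intro H_image_one) (auto simp: gen_equations_def)
  moreover have "u \<in> {0..1} - (range F \<union> {0, 1})" using u' by auto
  ultimately obtain L where
    "if Fm ?a > 0 then (\<phi> \<longlongrightarrow> L) (at_left (Fm ?a)) else L = 0"
    and "\<phi> u = (H ?a - L) / (F ?a - Fm ?a) * (u - Fm ?a) + L"
    using \<phi> unfolding gen_equations_def under_eq over_def by metis
  then show ?thesis
    using left_limit_unique[OF \<phi> refl _ a(2)] sol_gap[OF u'] by (auto split: if_splits)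
qed

lemma sol_unique: "\<exists>!\<phi>. \<phi> \<in> extensional {0..1} \<and> gen_equations H F \<phi>"
proof (rule ex1I[of _ sol])
  show "sol \<in> extensional {0..1} \<and> gen_equations H F sol"
    using sol_equations by (auto simp: extensional_def sol_def)
  then show "\<phi> = sol" if "\<phi> \<in> extensional {0..1} \<and> gen_equations H F \<phi>" for \<phi>
    using that equations_imp_sol[of \<phi>] extensionalityI[of \<phi> "{0..1}" sol] by auto
qed

end

lemma gen_fun_well_defined:
  assumes "real_distribution P" "real_distribution Q"
  defines "F \<equiv> (\<lambda>x. cdf P x * cdf Q x)"
  shows "\<exists>!\<phi>. \<phi> \<in> extensional {0..1} \<and> gen_equations (cdf P) F \<phi>"
proof -
  interpret p: cdf_product P Q using assms by (simp add: cdf_product_def)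
  show ?thesis using p.sol_unique unfolding p.H_def p.F_def F_def .
qed

end

theory Submission
  imports Defs
begin

text \<open>
  The maximum \<open>U\<close> has distribution function \<open>F = F\<^sub>X G\<^sub>1\<close>, so \<open>\<phi>\<close> runs through the points \<open>(F x, F\<^sub>X x)\<close>
  and the left-limit points \<open>(F (x-), F\<^sub>X (x-))\<close> and is linear in between.  Since
  \<open>F\<^sub>X x / F x = 1 / G\<^sub>1 x\<close>, passing from one such point to a later one increases the ordinate and
  decreases the ratio of ordinate to abscissa, and linear interpolation preserves both properties;
  hence \<open>\<phi>\<close> is a generating function.  By comonotonicity one of the events \<open>Z\<^sub>1 \<le> x\<close>, \<open>Z\<^sub>2 \<le> y\<close> is
  almost surely contained in the other, so only the independence of \<open>X, Y, Z\<^sub>i\<close> for a single \<open>i\<close> is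
  needed to get \<open>P (U \<le> x, V \<le> y) = F\<^sub>X x F\<^sub>Y y min {G\<^sub>1 x, G\<^sub>2 y}\<close>.
\<close>

section \<open>Points ordered by ordinate and by ratio\<close>

text \<open>Division-free form of \<open>p \<le> q\<close> and \<open>q / v \<le> p / u\<close>,
  meaningful also at abscissa 0, where a chord may start.\<close>

definition star_order :: "real \<Rightarrow> real \<Rightarrow> real \<Rightarrow> real \<Rightarrow> bool" where
  "star_order u p v q \<longleftrightarrow> p \<le> q \<and> q * u \<le> p * v"

text \<open>The two ratio inequalities chain after multiplication by the outer abscissae; the middle
  abscissa \<open>v\<close> is then cancelled, hence its positivity.\<close>

lemma star_order_trans:
  assumes "star_order u p v q" "star_order v q w r" "0 \<le> u" "0 < v" "0 \<le> w"
  shows "star_order u p w r"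
proof -
  have "(r * v) * u \<le> (q * w) * u" and "(q * u) * w \<le> (p * v) * w"
    using assms by (auto simp: star_order_def intro!: mult_right_mono)
  then have "(r * u) * v \<le> (p * w) * v" by (simp add: mult_ac)
  then have "r * u \<le> p * w" using assms(4) by simp
  then show ?thesis using assms by (auto simp: star_order_def)
qed

text \<open>The slope makes the ordinate increase, and the intercept
  \<open>A - s * a \<ge> 0\<close> makes the ratio decrease.\<close>

lemma star_order_line:
  fixes s :: real
  assumes "0 \<le> s" "s * a \<le> A" "t \<le> t'"
  shows "star_order t (s * (t - a) + A) t' (s * (t' - a) + A)"
proof -
  have "(A - s * a) * t \<le> (A - s * a) * t'" and "s * t \<le> s * t'"
    using assms by (auto intro!: mult_left_mono)
  then show ?thesis unfolding star_order_def by (auto simp: algebra_simps)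
qed

section \<open>Generating functions and Marshall copulas\<close>

lemma marshall_generatorI:
  assumes "f 0 = 0" "f 1 = 1" "\<And>u. 0 < u \<Longrightarrow> u \<le> 1 \<Longrightarrow> 0 \<le> f u"
    and "\<And>u v. 0 < u \<Longrightarrow> u \<le> v \<Longrightarrow> v \<le> 1 \<Longrightarrow> star_order u (f u) v (f v)"
  shows "marshall_generator f"
proof -
  have nonneg: "0 \<le> f u" if "u \<in> {0..1}" for u
    using that assms(1,3) by (cases "u = 0") auto
  have mono: "f u \<le> f v" if "0 \<le> u" "u \<le> v" "v \<le> 1" for u v
    using that assms(1,4) nonneg[of v] by (cases "u = 0") (auto simp: star_order_def)
  have "f u \<le> 1" if "u \<in> {0..1}" for u
    using mono[of u 1] that assms(2) by simp
  moreover have "f v / v \<le> f u / u" if "0 < u" "u \<le> v" "v \<le> 1" for u v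
    using assms(4)[OF that] that by (simp add: star_order_def field_simps)
  ultimately show ?thesis
    using nonneg mono assms(1,2)
    by (auto simp: marshall_generator_def monotone_on_def)
qed

lemma marshall_generator_star_order:
  assumes "marshall_generator f" "0 \<le> u" "u \<le> v" "v \<le> 1"
  shows "f v * u \<le> f u * v"
proof (cases "u = 0")
  case True
  then show ?thesis using assms by (simp add: marshall_generator_def)
next
  case False
  then have "f v / v \<le> f u / u"
    using assms by (auto simp: marshall_generator_def monotone_on_def)
  then show ?thesis using False assms by (simp add: field_simps)
qed

lemma marshall_swap: "marshall f g u v = marshall g f v u"
  by (simp add: marshall_def min.commute mult.commute)

text \<open>If the branch \<open>u * g v\<close> is minimal at both \<open>(u2, v2)\<close> and
  \<open>(u1, v1)\<close>, bounding the mixed corners by it leaves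
  \<open>(u2 - u1) * (g v2 - g v1)\<close>. Otherwise the mixed corners are bounded by different
  branches, and the decrease of \<open>f u / u\<close> limits the growth of
  \<open>f\<close>.\<close>

lemma marshall_rectangle_aux:
  assumes f: "marshall_generator f" and g: "marshall_generator g"
    and u: "0 \<le> u1" "u1 \<le> u2" "u2 \<le> 1" and v: "0 \<le> v1" "v1 \<le> v2" "v2 \<le> 1"
    and min: "u2 * g v2 \<le> f u2 * v2"
  shows "marshall f g u1 v2 + marshall f g u2 v1 \<le> marshall f g u2 v2 + marshall f g u1 v1"
proof -
  have gm: "g v1 \<le> g v2" and fm: "f u1 \<le> f u2" and f0: "0 \<le> f u1" "f 0 = 0" and g0: "0 \<le> g v1"
    using f g u v by (auto simp: marshall_generator_def monotone_on_def image_subset_iff)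
  have C22: "marshall f g u2 v2 = u2 * g v2" using min by (simp add: marshall_def)
  show ?thesis
  proof (cases "u1 * g v1 \<le> f u1 * v1")
    case True
    have "0 \<le> (u2 - u1) * (g v2 - g v1)" using gm u by simp
    then show ?thesis
      using True unfolding C22 by (simp add: marshall_def algebra_simps min_def)
  next
    case False
    then have lt: "f u1 * v1 < u1 * g v1" by simp
    then have "u1 \<noteq> 0" using f0 by auto
    then have u1: "0 < u1" using u by simp
    have "v1 * (f u2 * u1) \<le> v1 * (f u1 * u2)"
      using marshall_generator_star_order[OF f u] v by (intro mult_left_mono) auto
    \<comment> \<open>Subtracting \<open>v1 * f u1 * u1\<close> on both sides turns the ratio
      condition into a bound on the increment of \<open>f\<close>.\<close>
    then have "u1 * (v1 * (f u2 - f u1)) \<le> (u2 - u1) * (f u1 * v1)" by (simp add: algebra_simps)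
    also have "\<dots> \<le> (u2 - u1) * (u1 * g v1)" using lt u by (intro mult_left_mono) auto
    also have "\<dots> \<le> (u2 - u1) * (u1 * g v2)" using gm u by (intro mult_left_mono) auto
    finally have "u1 * (v1 * (f u2 - f u1)) \<le> u1 * ((u2 - u1) * g v2)" by (simp add: mult_ac)
    then have "v1 * (f u2 - f u1) \<le> (u2 - u1) * g v2" using u1 by simp
    moreover have "marshall f g u1 v1 = f u1 * v1" using lt by (simp add: marshall_def)
    moreover have "marshall f g u1 v2 \<le> u1 * g v2" "marshall f g u2 v1 \<le> f u2 * v1"
      by (simp_all add: marshall_def)
    ultimately show ?thesis unfolding C22 by (simp add: algebra_simps)
  qed
qed

lemma marshall_copula:
  assumes f: "marshall_generator f" and g: "marshall_generator g"
  shows "copula (marshall f g)"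
proof -
  have range: "0 \<le> f u" "f u \<le> 1" "0 \<le> g u" "g u \<le> 1" if "u \<in> {0..1}" for u
    using f g that by (auto simp: marshall_generator_def image_subset_iff)
  \<comment> \<open>On the edges the formula reads \<open>min u (f u)\<close> and
    \<open>min (g v) v\<close>, so these bounds yield the uniform margins.\<close>
  have ge: "x \<le> f x" "x \<le> g x" if "x \<in> {0..1}" for x
    using marshall_generator_star_order[OF f, of x 1] marshall_generator_star_order[OF g, of x 1] that f g
    by (auto simp: marshall_generator_def)
  have boundary: "f 0 = 0" "g 0 = 0" "f 1 = 1" "g 1 = 1"
    using f g by (auto simp: marshall_generator_def)
  have "marshall f g u v \<in> {0..1}" if "u \<in> {0..1}" "v \<in> {0..1}" for u v
    using range[OF that(1)] range[OF that(2)] that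
    by (auto simp: marshall_def min_le_iff_disj intro: mult_le_one)
  moreover have "marshall f g u2 v2 - marshall f g u1 v2 - marshall f g u2 v1 + marshall f g u1 v1 \<ge> 0"
    if "u1 \<in> {0..1}" "u2 \<in> {0..1}" "v1 \<in> {0..1}" "v2 \<in> {0..1}" "u1 \<le> u2" "v1 \<le> v2" for u1 u2 v1 v2
  proof (cases "u2 * g v2 \<le> f u2 * v2")
    case True
    then show ?thesis using marshall_rectangle_aux[OF f g, of u1 u2 v1 v2] that by simp
  next
    case False
    \<comment> \<open>Exchanging the coordinates together with the generators reduces this branch to
      the previous one.\<close>
    then have "v2 * f u2 \<le> g v2 * u2" by (simp add: mult.commute)
    then show ?thesis
      using marshall_rectangle_aux[OF g f, of v1 v2 u1 u2] that by (simp add: marshall_swap[of f g])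
  qed
  ultimately show ?thesis
    using ge boundary unfolding copula_def by (simp add: marshall_def min_absorb1 min_absorb2)
qed

section \<open>The solution of the defining equations as a generating function\<close>

context cdf_product
begin

text \<open>Encodes the convention \<open>\<phi>(0-) = 0\<close>: when \<open>Fm a = 0\<close>
  because \<open>Gm a\<close> vanishes, \<open>Hm a\<close> may still be positive.\<close>

definition lower :: "real \<Rightarrow> real" where "lower a = (if Fm a > 0 then Hm a else 0)"

text \<open>For \<open>F a = Fm a\<close> the division by zero makes this the constant \<open>lower a\<close>, as desired.\<close>

definition chord :: "real \<Rightarrow> real \<Rightarrow> real" where
  "chord a t = (H a - lower a) / (F a - Fm a) * (t - Fm a) + lower a"

lemma chord_lower: "chord a (Fm a) = lower a"
  by (simp add: chord_def)

text \<open>Without a jump of \<open>F\<close> at \<open>a\<close> the chord is the constant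
  \<open>lower a\<close>; equality of the positive products then forces
  \<open>Hm a = H a\<close>.\<close>

lemma chord_upper: "0 < F a \<Longrightarrow> chord a (F a) = H a"
  using Hm_eq_H[of a] by (cases "Fm a = F a") (auto simp: chord_def lower_def)

lemma lower_nonneg: "0 \<le> lower a"
  using Hm_nonneg by (simp add: lower_def)

lemma lower_le: "lower a \<le> H a"
  using Hm_H H_range by (simp add: lower_def)

text \<open>For \<open>Fm a > 0\<close> the ratio falls from \<open>1 / Gm a\<close> to
  \<open>1 / G a\<close> along the chord. This keeps the ordinate nonnegative when the chord is
  extended to abscissa 0.\<close>

lemma H_Fm_le: "H a * Fm a \<le> lower a * F a"
proof (cases "Fm a > 0")
  case True
  have "H a * Hm a * Gm a \<le> H a * Hm a * G a"
    using Gm_G H_range Hm_nonneg by (intro mult_left_mono) auto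
  then show ?thesis using True by (simp add: lower_def F_eq Fm_def mult_ac)
next
  case False
  then show ?thesis using Fm_nonneg[of a] by (simp add: lower_def)
qed

lemma star_order_chord:
  assumes "t \<le> t'"
  shows "star_order t (chord a t) t' (chord a t')"
proof -
  have "(H a - lower a) / (F a - Fm a) * Fm a \<le> lower a"
  proof (cases "Fm a = F a")
    case True
    then show ?thesis using lower_nonneg by simp
  next
    case False
    then have "0 < F a - Fm a" using Fm_F[of a] by simp
    then show ?thesis using H_Fm_le[of a] by (simp add: field_simps)
  qed
  moreover have "0 \<le> (H a - lower a) / (F a - Fm a)"
    using lower_le[of a] Fm_F[of a] by simp
  ultimately show ?thesis unfolding chord_def using assms by (intro star_order_line)
qed

text \<open>Leads from the right end of one chord to the left end of a later one: the ratios are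
  \<open>1 / G a\<close> and \<open>1 / Gm b\<close>, and \<open>G a \<le> Gm b\<close>.\<close>

lemma star_order_jump:
  assumes "a < b"
  shows "star_order (F a) (H a) (Fm b) (Hm b)"
proof -
  have "H a * Hm b * G a \<le> H a * Hm b * Gm b"
    using G_Gm[OF assms] H_range Hm_nonneg by (intro mult_left_mono) auto
  then show ?thesis using H_Hm[OF assms] by (simp add: star_order_def F_eq Fm_def mult_ac)
qed

lemma quantile_bounds:
  assumes "0 < u" "u < 1"
  shows "Fm (quantile F u) \<le> u" "u \<le> F (quantile F u)"
proof -
  show "Fm (quantile F u) \<le> u"
    using quantile_le[OF assms] by (intro Fm_le) (meson linorder_not_le order_less_imp_le)
  show "u \<le> F (quantile F u)" using quantile_le[OF assms] by simp
qed

text \<open>A point \<open>u\<close> of the image satisfies \<open>F (quantile F u) = u\<close>,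
  hence is the right end of its chord; one formula thus covers both clauses of the
  definition.\<close>

lemma sol_chord:
  assumes "0 < u" "u < 1"
  shows "sol u = chord (quantile F u) u"
proof (cases "u \<in> range F")
  case True
  then obtain x where x: "u = F x" by auto
  then have Fa: "F (quantile F u) = u" using quantile_image(2)[of x] assms by simp
  then have "sol u = H (quantile F u)" using sol_image[of "quantile F u"] assms by simp
  then show ?thesis using chord_upper[of "quantile F u"] Fa assms by simp
next
  case False
  then show ?thesis using sol_gap[OF assms False] by (simp add: chord_def lower_def)
qed

lemma star_order_sol_upper:
  assumes "0 < u" "u < 1"
  shows "star_order u (sol u) (F (quantile F u)) (H (quantile F u))"
  using star_order_chord[OF quantile_bounds(2)[OF assms], of "quantile F u"]
    chord_upper[of "quantile F u"] quantile_bounds(2)[OF assms] assms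
  by (simp add: sol_chord)

lemma sol_one: "sol 1 = 1"
  by (simp add: sol_def)

lemma sol_nonneg:
  assumes "0 < u" "u \<le> 1"
  shows "0 \<le> sol u"
proof (cases "u = 1")
  case False
  then have u: "0 < u" "u < 1" using assms by auto
  show ?thesis
    using star_order_chord[OF quantile_bounds(1)[OF u], of "quantile F u"]
      lower_nonneg[of "quantile F u"] u
    by (simp add: sol_chord star_order_def chord_lower)
qed (simp add: sol_one)

text \<open>Two points on one chord are compared directly. Otherwise the path runs along the chord
  at \<open>a\<close> to its right end, jumps to the left end of the chord at \<open>b\<close>, and
  follows that chord to \<open>v\<close>.\<close>

lemma star_order_sol:
  assumes "0 < u" "u \<le> v" "v \<le> 1"
  shows "star_order u (sol u) v (sol v)"
proof (cases "u = v")
  case True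
  then show ?thesis by (simp add: star_order_def)
next
  case False
  then have u: "0 < u" "u < 1" using assms by auto
  define a where "a = quantile F u"
  have Fa: "u \<le> F a" using quantile_bounds[OF u] by (simp add: a_def)
  have ua: "star_order u (sol u) (F a) (H a)" using star_order_sol_upper[OF u] by (simp add: a_def)
  show ?thesis
  proof (cases "v = 1")
    case True
    \<comment> \<open>The quantile is only used strictly below 1, so \<open>(1, 1)\<close> is
      reached directly, from \<open>H a \<le> 1\<close> and \<open>F a \<le> H a\<close>.\<close>
    have "star_order (F a) (H a) 1 1"
      using H_range[of a] G_range[of a] by (simp add: star_order_def F_eq mult_left_le)
    then show ?thesis using star_order_trans[OF ua] True Fa u by (simp add: sol_one)
  next
    case False
    then have v: "0 < v" "v < 1" using assms by auto
    define b where "b = quantile F v"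
    have Fb: "Fm b \<le> v" "v \<le> F b" using quantile_bounds[OF v] by (auto simp: b_def)
    have "a \<le> b" using quantile_le[OF u, of b] Fb assms by (simp add: a_def)
    show ?thesis
    proof (cases "a = b")
      case True
      then show ?thesis
        using star_order_chord[OF assms(2), of a] by (simp add: sol_chord u v a_def b_def)
    next
      case False
      then have "a < b" using \<open>a \<le> b\<close> by simp
      \<comment> \<open>Positivity of \<open>Fm b\<close> identifies \<open>lower b\<close> with
        \<open>Hm b\<close>; both values serve as middle abscissae for transitivity.\<close>
      then have pos: "0 < F a" "0 < Fm b" using F_Fm[of a b] Fa u by auto
      have "star_order (Fm b) (Hm b) v (sol v)"
        using star_order_chord[OF Fb(1), of b] pos by (simp add: sol_chord v b_def chord_lower lower_def)
      with star_order_jump[OF \<open>a < b\<close>] have "star_order (F a) (H a) v (sol v)"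
        by (rule star_order_trans) (use pos v in auto)
      with ua show ?thesis by (rule star_order_trans) (use pos u v in auto)
    qed
  qed
qed

lemma marshall_generator_sol: "marshall_generator sol"
  by (intro marshall_generatorI star_order_sol sol_nonneg sol_one) (auto simp: sol_def)

lemma gen_fun_eq_sol: "gen_fun H F = sol"
  unfolding gen_fun_def
  using sol_equations by (intro the1_equality[OF sol_unique]) (auto simp: extensional_def sol_def)

end

lemma marshall_generator_gen_fun:
  assumes "real_distribution P" "real_distribution Q" "F = (\<lambda>x. cdf P x * cdf Q x)"
  shows "marshall_generator (gen_fun (cdf P) F)"
proof -
  interpret p: cdf_product P Q using assms by (simp add: cdf_product_def)
  show ?thesis using p.marshall_generator_sol assms(3) by (simp add: p.H_def p.F_def flip: p.gen_fun_eq_sol)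
qed

lemma gen_fun_image:
  assumes "real_distribution P" "real_distribution Q" "F = (\<lambda>x. cdf P x * cdf Q x)" "0 < F x"
  shows "gen_fun (cdf P) F (F x) = cdf P x"
proof -
  interpret p: cdf_product P Q using assms by (simp add: cdf_product_def)
  show ?thesis using p.sol_image[of x] assms(3,4) by (simp add: p.H_def p.F_def flip: p.gen_fun_eq_sol)
qed

section \<open>Distribution functions of the maxima\<close>

context prob_space
begin

lemma dist_fun_eq: "W \<in> borel_measurable M \<Longrightarrow> dist_fun M W x = prob {\<omega> \<in> space M. W \<omega> \<le> x}"
  unfolding dist_fun_def cdf_def
  by (subst measure_distr) (auto intro!: arg_cong[where f = prob])

text \<open>Stated for arbitrary Borel sets so that \<open>UNIV\<close> can remove a variable from
  the product.\<close>

lemma indep_vars_triple_prob: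
  assumes "indep_vars (\<lambda>_. borel) (\<lambda>i. [X, Y, Z] ! i) {..<3}"
    and "A \<in> sets borel" "B \<in> sets borel" "C \<in> sets borel"
  shows "prob {\<omega> \<in> space M. X \<omega> \<in> A \<and> Y \<omega> \<in> B \<and> Z \<omega> \<in> C} =
    prob {\<omega> \<in> space M. X \<omega> \<in> A} * prob {\<omega> \<in> space M. Y \<omega> \<in> B} * prob {\<omega> \<in> space M. Z \<omega> \<in> C}"
proof -
  have I: "{..<3} = {0, 1, 2::nat}" by auto
  have "prob (\<Inter>i\<in>{..<3}. ([X, Y, Z] ! i) -` ([A, B, C] ! i) \<inter> space M) =
     (\<Prod>i\<in>{..<3}. prob (([X, Y, Z] ! i) -` ([A, B, C] ! i) \<inter> space M))"
    using assms(2-4) by (intro indep_varsD[OF assms(1)]) (auto simp: I)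
  then show ?thesis
    by (simp add: I Int_def vimage_def conj_ac mult_ac)
qed

lemma dist_fun_max_first:
  assumes "indep_vars (\<lambda>_. borel) (\<lambda>i. [X, Y, Z] ! i) {..<3}"
    and [measurable]: "X \<in> borel_measurable M" "Z \<in> borel_measurable M"
  shows "dist_fun M (\<lambda>\<omega>. max (X \<omega>) (Z \<omega>)) x = dist_fun M X x * dist_fun M Z x"
  using indep_vars_triple_prob[OF assms(1), of "{..x}" UNIV "{..x}"]
  by (simp add: dist_fun_eq prob_space)

lemma dist_fun_max_second:
  assumes "indep_vars (\<lambda>_. borel) (\<lambda>i. [X, Y, Z] ! i) {..<3}"
    and [measurable]: "Y \<in> borel_measurable M" "Z \<in> borel_measurable M"
  shows "dist_fun M (\<lambda>\<omega>. max (Y \<omega>) (Z \<omega>)) y = dist_fun M Y y * dist_fun M Z y"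
  using indep_vars_triple_prob[OF assms(1), of UNIV "{..y}" "{..y}"]
  by (simp add: dist_fun_eq prob_space)

text \<open>The hypothesis says that \<open>A - B\<close> is a null set, and
  \<open>E \<inter> A - B\<close> lies inside it.\<close>

lemma prob_Int_full:
  assumes "E \<in> events" "A \<in> events" "B \<in> events" "prob (A \<inter> B) = prob A"
  shows "prob (E \<inter> A \<inter> B) = prob (E \<inter> A)"
proof -
  have "prob (A - B) = 0" using assms by (simp add: finite_measure_Diff')
  moreover have "prob (E \<inter> A - B) \<le> prob (A - B)"
    using assms by (intro finite_measure_mono) auto
  moreover have "prob (E \<inter> A - B) = prob (E \<inter> A) - prob (E \<inter> A \<inter> B)"
    using assms by (intro finite_measure_Diff') auto
  ultimately show ?thesis
    by (metis antisym_conv measure_nonneg right_minus_eq)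
qed

lemma joint_dist_fun_max:
  assumes [measurable]: "X \<in> borel_measurable M" "Y \<in> borel_measurable M"
      "Z1 \<in> borel_measurable M" "Z2 \<in> borel_measurable M"
    and ind1: "indep_vars (\<lambda>_. borel) (\<lambda>i. [X, Y, Z1] ! i) {..<3}"
    and ind2: "indep_vars (\<lambda>_. borel) (\<lambda>i. [X, Y, Z2] ! i) {..<3}"
    and com: "comonotonic M Z1 Z2"
  shows "joint_dist_fun M (\<lambda>\<omega>. max (X \<omega>) (Z1 \<omega>)) (\<lambda>\<omega>. max (Y \<omega>) (Z2 \<omega>)) x y =
    dist_fun M X x * dist_fun M Y y * min (dist_fun M Z1 x) (dist_fun M Z2 y)"
proof -
  let ?E = "{\<omega> \<in> space M. X \<omega> \<le> x \<and> Y \<omega> \<le> y}"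
  let ?A = "{\<omega> \<in> space M. Z1 \<omega> \<le> x}"
  let ?B = "{\<omega> \<in> space M. Z2 \<omega> \<le> y}"
  have joint: "joint_dist_fun M (\<lambda>\<omega>. max (X \<omega>) (Z1 \<omega>)) (\<lambda>\<omega>. max (Y \<omega>) (Z2 \<omega>)) x y
      = prob (?E \<inter> ?A \<inter> ?B)"
    unfolding joint_dist_fun_def by (auto intro!: arg_cong[where f = prob])
  have "?A \<inter> ?B = {\<omega> \<in> space M. Z1 \<omega> \<le> x \<and> Z2 \<omega> \<le> y}" by auto
  then have AB: "prob (?A \<inter> ?B) = min (prob ?A) (prob ?B)"
    using com by (simp add: comonotonic_def joint_dist_fun_def dist_fun_eq)
  have EA: "prob (?E \<inter> ?A) = dist_fun M X x * dist_fun M Y y * dist_fun M Z1 x"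
    using indep_vars_triple_prob[OF ind1, of "{..x}" "{..y}" "{..x}"]
    by (simp add: dist_fun_eq Int_def conj_ac)
  have EB: "prob (?E \<inter> ?B) = dist_fun M X x * dist_fun M Y y * dist_fun M Z2 y"
    using indep_vars_triple_prob[OF ind2, of "{..x}" "{..y}" "{..y}"]
    by (simp add: dist_fun_eq Int_def conj_ac)
  show ?thesis
  proof (cases "prob ?A \<le> prob ?B")
    case True
    then have "prob (?E \<inter> ?A \<inter> ?B) = prob (?E \<inter> ?A)"
      using AB by (intro prob_Int_full) auto
    then show ?thesis using True EA joint by (simp add: dist_fun_eq)
  next
    case False
    then have "prob (?E \<inter> ?B \<inter> ?A) = prob (?E \<inter> ?B)"
      using AB by (intro prob_Int_full) (auto simp: Int_commute)
    then show ?thesis using False EB joint by (simp add: dist_fun_eq Int_ac)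
  qed
qed

end

theorem proposition1:
  fixes M :: "'a measure"
    and X Y Z1 Z2 U V :: "'a \<Rightarrow> real"
    and \<phi> \<psi> :: "real \<Rightarrow> real"
  assumes "prob_space M"
    and "X \<in> borel_measurable M" "Y \<in> borel_measurable M"
    and "Z1 \<in> borel_measurable M" "Z2 \<in> borel_measurable M"
    and "prob_space.indep_vars M (\<lambda>_. borel) (\<lambda>i. [X, Y, Z1] ! i) {..<3}"
    and "prob_space.indep_vars M (\<lambda>_. borel) (\<lambda>i. [X, Y, Z2] ! i) {..<3}"
    and "comonotonic M Z1 Z2"
    and "U = (\<lambda>\<omega>. max (X \<omega>) (Z1 \<omega>))"
    and "V = (\<lambda>\<omega>. max (Y \<omega>) (Z2 \<omega>))"
    and "\<phi> = gen_fun (dist_fun M X) (dist_fun M U)"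
    and "\<psi> = gen_fun (dist_fun M Y) (dist_fun M V)"
  shows "marshall_generator \<phi> \<and> marshall_generator \<psi> \<and> copula_of M U V (marshall \<phi> \<psi>)"
proof -
  interpret prob_space M by fact
  note meas [measurable] = assms(2-5)
  note ind1 = assms(6) and ind2 = assms(7)
  have dist: "real_distribution (distr M borel W)" if "W \<in> borel_measurable M" for W
    using that by (simp add: real_distribution_distr)
  have FU: "dist_fun M U x = dist_fun M X x * dist_fun M Z1 x" for x
    using dist_fun_max_first[OF ind1] by (simp add: assms(9))
  have FV: "dist_fun M V x = dist_fun M Y x * dist_fun M Z2 x" for x
    using dist_fun_max_second[OF ind2] by (simp add: assms(10))
  have FU': "dist_fun M U = (\<lambda>x. cdf (distr M borel X) x * cdf (distr M borel Z1) x)"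
    using FU by (auto simp: dist_fun_def)
  have FV': "dist_fun M V = (\<lambda>x. cdf (distr M borel Y) x * cdf (distr M borel Z2) x)"
    using FV by (auto simp: dist_fun_def)
  have \<phi>_gen: "marshall_generator \<phi>"
    unfolding assms(11) dist_fun_def[of M X]
    by (rule marshall_generator_gen_fun[OF dist dist FU']) (rule meas)+
  have \<psi>_gen: "marshall_generator \<psi>"
    unfolding assms(12) dist_fun_def[of M Y]
    by (rule marshall_generator_gen_fun[OF dist dist FV']) (rule meas)+
  have \<phi>_image: "\<phi> (dist_fun M U x) = dist_fun M X x" if "dist_fun M U x > 0" for x
    unfolding assms(11) dist_fun_def[of M X]
    by (rule gen_fun_image[OF dist dist FU' that]) (rule meas)+
  have \<psi>_image: "\<psi> (dist_fun M V y) = dist_fun M Y y" if "dist_fun M V y > 0" for y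
    unfolding assms(12) dist_fun_def[of M Y]
    by (rule gen_fun_image[OF dist dist FV' that]) (rule meas)+
  have nonneg: "0 \<le> dist_fun M W x" for W x
    by (simp add: dist_fun_def cdf_def)
  have copC: "copula (marshall \<phi> \<psi>)" using \<phi>_gen \<psi>_gen by (rule marshall_copula)
  have "joint_dist_fun M U V x y = marshall \<phi> \<psi> (dist_fun M U x) (dist_fun M V y)" for x y
  proof -
    let ?p = "dist_fun M X x * dist_fun M Y y"
    have "joint_dist_fun M U V x y = ?p * min (dist_fun M Z1 x) (dist_fun M Z2 y)"
      unfolding assms(9,10) by (rule joint_dist_fun_max) (rule assms)+
    also have "\<dots> = min (?p * dist_fun M Z1 x) (?p * dist_fun M Z2 y)"
      using nonneg by (simp add: min_mult_distrib_left)
    also have "\<dots> = min (dist_fun M U x * dist_fun M Y y) (dist_fun M X x * dist_fun M V y)"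
      by (simp add: FU FV mult_ac)
    also have "\<dots> = marshall \<phi> \<psi> (dist_fun M U x) (dist_fun M V y)"
    \<comment> \<open>\<open>\<phi>\<close> recovers \<open>F_X\<close> only where
      \<open>F_U\<close> is positive: at a zero of \<open>F_U\<close> the value of
      \<open>F_X\<close> may be positive while \<open>\<phi> 0 = 0\<close>. If either marginal value
      vanishes, both sides are 0.\<close>
    proof (cases "dist_fun M U x > 0 \<and> dist_fun M V y > 0")
      case True
      then show ?thesis by (simp add: marshall_def \<phi>_image \<psi>_image)
    next
      case False
      have "dist_fun M W z \<in> {0..1}" if "W \<in> borel_measurable M" for W z
        using that nonneg by (simp add: dist_fun_eq)
      then have r: "dist_fun M U x \<in> {0..1}" "dist_fun M V y \<in> {0..1}"
        unfolding assms(9,10) by measurable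
      from False nonneg consider "dist_fun M U x = 0" | "dist_fun M V y = 0"
        by (metis order_le_less)
      then show ?thesis
        using r copC nonneg by cases (simp_all add: copula_def min_absorb1 min_absorb2)
    qed
    finally show ?thesis .
  qed
  then show ?thesis using \<phi>_gen \<psi>_gen copC by (simp add: copula_of_def)
qed

end
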